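(* Consider anonymous agents in the synchronous model with FW whiteboards, with half-duplex or full-duplex links. In each of these models, for every $k \ge 1$, the quiescence number of the $k$-gossip problem is not larger than $k-1$ and not smaller than $0$.
   Context: Network: a finite connected graph $G=(V,E)$. Nodes are anonymous (nodes of the same degree are identical). Each node labels its incident links with locally distinct labels; nothing else is assumed about the labels. Each node has a whiteboard (a public memory). Agents: $k$ mobile agents, each a deterministic state machine (with no a priori bound on its number of states), are present at all times. In the anonymous agent model agents have no identifiers and are all identical. When an agent at a node executes its action, it may change its state, write on the node's whiteboard, and move to a neighboring node (or stay), based only on: its own state, the states of the agents currently at the same node, the local link labels of the node (and possibly the label of the incoming link), and the contents of the node's whiteboard. The algorithm is the same for all agents; it is given neither $k$ nor the network. Synchronous model: lock-step rounds; in each round every agent executes its action and can move to a neighboring node; agents at the same node act in sequence within the round. Whiteboards may also hold count-up timers that are increased by one automatically at every round. Links. Full-duplex: two agents at neighboring nodes can swap positions simultaneously over the link joining them without meeting. Half-duplex: only one direction can be used at a time; if two agents at opposite ends try to cross simultaneously, only one succeeds. FW whiteboards: any information can be stored on whiteboards, including gossip information. $k$-gossip problem: each of the $k$ agents is given an initial piece of information (gossip information), treated as opaque. Gossip information is transferred from agent to agent by meeting at a node or by being written on and read from a whiteboard; agents may relay all gossip information collected. The goal is that every agent obtains the gossip information of all agents. Self-stabilizing solution: one algorithm, not depending on $k$ or on the network, such that for every network, every number of agents, and every initial configuration (arbitrary agent locations and states, arbitrary whiteboard contents), in every execution every agent eventually knows the gossip information of all agents in the system. $l$-quiescent (for an integer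 $l$, when $k$ agents are present): every execution with $k$ agents reaches a configuration after which $l$ or more agents remain still (never move) forever. The quiescence number of the $k$-gossip problem in a model is the maximum integer $l$ such that an $l$-quiescent self-stabilizing solution exists, and it is $-1$ if no $0$-quiescent self-stabilizing solution exists. *)

theory Defs
  imports "Graph_Theory.Graph_Theory" "HOL-Library.Multiset"
begin

type_synonym node = nat
type_synonym label = nat
type_synonym state = nat
type_synonym gossip = nat
type_synonym agent = nat

text \<open>
  A network is a finite connected simple graph (a symmetric loop-free pair digraph); the label
  that node \<open>u\<close> gives to its link with \<open>v\<close> is \<open>port N u v\<close>.
\<close>

record network =
  topo :: "node pair_pre_digraph"
  port :: "node \<Rightarrow> node \<Rightarrow> label"

definition nbrs :: "network \<Rightarrow> node \<Rightarrow> node set" where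
  "nbrs N v = {w. (v, w) \<in> parcs (topo N)}"

definition network :: "network \<Rightarrow> bool" where
  "network N \<longleftrightarrow> pair_graph (topo N) \<and> connected (with_proj (topo N)) \<and>
     (\<forall>v \<in> pverts (topo N). inj_on (port N v) (nbrs N v))"

definition ports :: "network \<Rightarrow> node \<Rightarrow> label set" where
  "ports N v = port N v ` nbrs N v"

text \<open>
  Control memory is finitely describable data and is coded by natural numbers, so an agent has
  countably many states and a whiteboard holds arbitrary control data together with any finite
  number of count-up timers.
\<close>

type_synonym board = "nat \<times> nat list"

definition tick :: "board \<Rightarrow> board" where
  "tick b = (fst b, map Suc (snd b))"

text \<open>
  An algorithm maps the own state, the multiset of states of the other agents at the node, the link
  labels of the node, the label of the incoming link (\<open>None\<close> if the agent did not move in the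
  previous round) and the whiteboard to the new state, the new whiteboard and the label of the link
  to move along (\<open>None\<close> to stay). Gossip is opaque, hence it is not an argument.
\<close>

type_synonym algorithm =
  "state \<Rightarrow> state multiset \<Rightarrow> label set \<Rightarrow> label option \<Rightarrow> board
    \<Rightarrow> state \<times> board \<times> label option"

text \<open>
  With \<open>k\<close> agents, the agents are \<open>0, \<dots>, k - 1\<close>; these names are not visible to the algorithm.
  \<open>known\<close> is the gossip held by an agent and \<open>posted\<close> the gossip held by a whiteboard.
\<close>

record config =
  pos :: "agent \<Rightarrow> node"
  st :: "agent \<Rightarrow> state"
  inc :: "agent \<Rightarrow> label option"
  known :: "agent \<Rightarrow> gossip set"
  wb :: "node \<Rightarrow> board"
  posted :: "node \<Rightarrow> gossip set"

definition present :: "nat \<Rightarrow> config \<Rightarrow> node \<Rightarrow> agent set" where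
  "present k c v = {i. i < k \<and> pos c i = v}"

text \<open>
  The action of agent \<open>i\<close>, on a configuration paired with the links chosen so far in this round.
  The agent collects all gossip available at its node (from the agents it meets and from the
  whiteboard) and leaves it on the whiteboard. As the control part does not depend on gossip,
  relaying everything gives the largest knowledge that the same moves can give.
\<close>

definition act :: "algorithm \<Rightarrow> network \<Rightarrow> nat \<Rightarrow> agent
    \<Rightarrow> config \<times> (agent \<Rightarrow> label option) \<Rightarrow> config \<times> (agent \<Rightarrow> label option)" where
  "act A N k i = (\<lambda>(c, out).
     let v = pos c i;
         others = image_mset (st c) (mset_set (present k c v - {i}));
         (s, b, m) = A (st c i) others (ports N v) (inc c i) (wb c v);
         K = posted c v \<union> (\<Union>j \<in> present k c v. known c j)
     in (c\<lparr>st := (st c)(i := s), known := (known c)(i := K),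
           wb := (wb c)(v := b), posted := (posted c)(v := K)\<rparr>,
         out(i := m)))"

text \<open>The agents at \<open>u\<close> that attempt to move along the link to \<open>v\<close>.\<close>

definition crossers :: "network \<Rightarrow> nat \<Rightarrow> config \<Rightarrow> (agent \<Rightarrow> label option)
    \<Rightarrow> node \<Rightarrow> node \<Rightarrow> agent set" where
  "crossers N k c out u v =
     {i \<in> present k c u. v \<in> nbrs N u \<and> out i = Some (port N u v)}"

datatype duplex = Full_Duplex | Half_Duplex

text \<open>
  \<open>admissible d X M\<close>: the agents in \<open>M\<close> may be exactly those whose attempts \<open>X\<close> to cross succeed.
  A half-duplex link attempted in both directions lets through one direction, chosen by the
  adversary; all agents crossing in that direction succeed.
\<close>

fun admissible :: "duplex \<Rightarrow> (node \<Rightarrow> node \<Rightarrow> agent set) \<Rightarrow> agent set \<Rightarrow> bool" where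
  "admissible Full_Duplex X M \<longleftrightarrow> M = (\<Union>u v. X u v)"
| "admissible Half_Duplex X M \<longleftrightarrow> M \<subseteq> (\<Union>u v. X u v) \<and>
     (\<forall>u v. X u v \<noteq> {} \<longrightarrow>
        (X u v \<subseteq> M \<and> X v u \<inter> M = {}) \<or>
        (X v u \<noteq> {} \<and> X v u \<subseteq> M \<and> X u v \<inter> M = {}))"

text \<open>
  One synchronous round: all agents act one after the other in some order (only the relative order
  of agents at the same node matters), then all moves take place simultaneously and all timers
  advance.
\<close>

definition round_step :: "duplex \<Rightarrow> algorithm \<Rightarrow> network \<Rightarrow> nat \<Rightarrow> config \<Rightarrow> config \<Rightarrow> bool" where
  "round_step d A N k c c' \<longleftrightarrow>
     (\<exists>ord M c1 out. distinct ord \<and> set ord = {..<k} \<and>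
        (c1, out) = fold (act A N k) ord (c, \<lambda>_. None) \<and>
        admissible d (crossers N k c1 out) M \<and>
        (\<forall>i<k. if i \<in> M
           then i \<in> crossers N k c1 out (pos c i) (pos c' i) \<and>
                inc c' i = Some (port N (pos c' i) (pos c i))
           else pos c' i = pos c i \<and> inc c' i = None) \<and>
        st c' = st c1 \<and> known c' = known c1 \<and>
        wb c' = tick \<circ> wb c1 \<and> posted c' = posted c1)"

text \<open>
  Initial configurations are arbitrary, except that every agent holds its own gossip, which is
  part of the problem input. Known and posted sets may also contain spurious gossip.
\<close>

definition initial :: "network \<Rightarrow> nat \<Rightarrow> (agent \<Rightarrow> gossip) \<Rightarrow> config \<Rightarrow> bool" where
  "initial N k gos c \<longleftrightarrow>
     (\<forall>i<k. pos c i \<in> pverts (topo N) \<and> set_option (inc c i) \<subseteq> ports N (pos c i) \<and>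
        gos i \<in> known c i)"

definition execution :: "duplex \<Rightarrow> algorithm \<Rightarrow> network \<Rightarrow> nat \<Rightarrow> (agent \<Rightarrow> gossip)
    \<Rightarrow> (nat \<Rightarrow> config) \<Rightarrow> bool" where
  "execution d A N k gos e \<longleftrightarrow>
     initial N k gos (e 0) \<and> (\<forall>t. round_step d A N k (e t) (e (Suc t)))"

definition self_stabilizing :: "duplex \<Rightarrow> algorithm \<Rightarrow> bool" where
  "self_stabilizing d A \<longleftrightarrow>
     (\<forall>N k gos e. network N \<longrightarrow> execution d A N k gos e \<longrightarrow>
        (\<forall>i<k. \<exists>t. \<forall>j<k. gos j \<in> known (e t) i))"

definition still_from :: "(nat \<Rightarrow> config) \<Rightarrow> nat \<Rightarrow> agent \<Rightarrow> bool" where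
  "still_from e t i \<longleftrightarrow> (\<forall>t'\<ge>t. pos (e t') i = pos (e t) i)"

definition quiescent :: "duplex \<Rightarrow> nat \<Rightarrow> int \<Rightarrow> algorithm \<Rightarrow> bool" where
  "quiescent d k l A \<longleftrightarrow>
     (\<forall>N gos e. network N \<longrightarrow> execution d A N k gos e \<longrightarrow>
        (\<exists>t. l \<le> int (card {i. i < k \<and> still_from e t i})))"

definition quiescent_solution :: "duplex \<Rightarrow> nat \<Rightarrow> int \<Rightarrow> algorithm \<Rightarrow> bool" where
  "quiescent_solution d k l A \<longleftrightarrow> self_stabilizing d A \<and> quiescent d k l A"

definition quiescence_number :: "duplex \<Rightarrow> nat \<Rightarrow> int" where
  "quiescence_number d k =
     (if \<exists>A. quiescent_solution d k 0 A
      then (GREATEST l. \<exists>A. quiescent_solution d k l A)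
      else - 1)"

end

theory Submission
  imports Defs
begin

text \<open>
  A self-stabilizing solution exists because of the rotor-router: agents arriving at a node are sent
  out along its links in cyclic order, and an agent that loses a contended half-duplex link insists
  on it. Every link is then crossed infinitely often in both directions, so whatever is posted at one
  node is eventually posted everywhere.

  No solution makes all agents quiescent: once all \<open>k\<close> agents stay still forever in a network
  with \<open>k + 1\<close> nodes, some node is unoccupied, and two copies of the situation joined by a link between
  these nodes cannot be told apart from the single one by any agent, so no gossip passes between them.
\<close>

section \<open>Networks and rounds\<close>

text \<open>Half-duplex links make the rotor-router delicate: the adversary may let the opposite
  direction win a contended link again and again. Insisting turns this into a counting problem. A
  loser stays committed, and every further turn of the rotor commits one more agent to the same
  link, so the losers would outgrow the finite number of agents. In the impossibility argument, the
  joining link must end at unoccupied nodes because it enlarges the label sets of its ends, which an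
  agent standing there would see. Also, stillness has to mean that no move is even attempted: it
  does, because every attempted link lets some agent through.\<close>

lemma networkD:
  assumes "network N"
  shows "finite (pverts (topo N))" "finite (parcs (topo N))"
    and "(u, v) \<in> parcs (topo N) \<Longrightarrow> u \<in> pverts (topo N)"
    and "(u, v) \<in> parcs (topo N) \<Longrightarrow> v \<in> pverts (topo N)"
    and "(u, v) \<in> parcs (topo N) \<Longrightarrow> (v, u) \<in> parcs (topo N)"
    and "(u, u) \<notin> parcs (topo N)"
    and "v \<in> nbrs N u \<Longrightarrow> v' \<in> nbrs N u \<Longrightarrow> port N u v = port N u v' \<Longrightarrow> v = v'"
proof -
  interpret pair_graph "topo N" using assms by (simp add: network_def)
  show "finite (pverts (topo N))" "finite (parcs (topo N))"
    by (fact pair_finite_verts, fact pair_finite_arcs)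
  show vts: "(u, v) \<in> parcs (topo N) \<Longrightarrow> u \<in> pverts (topo N)" for u v by (rule in_arcsD1)
  show "(u, v) \<in> parcs (topo N) \<Longrightarrow> v \<in> pverts (topo N)" by (rule in_arcsD2)
  show "(u, v) \<in> parcs (topo N) \<Longrightarrow> (v, u) \<in> parcs (topo N)" by (rule arcs_symmetric)
  show "(u, u) \<notin> parcs (topo N)" using pair_no_loops by fastforce
  show "v \<in> nbrs N u \<Longrightarrow> v' \<in> nbrs N u \<Longrightarrow> port N u v = port N u v' \<Longrightarrow> v = v'"
    using assms vts by (auto simp: network_def nbrs_def dest: inj_onD)
qed

lemma networkI:
  assumes fin: "finite (pverts (topo N))" and ne: "pverts (topo N) \<noteq> {}"
    and arcs: "parcs (topo N) \<subseteq> pverts (topo N) \<times> pverts (topo N)"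
    and sym: "sym (parcs (topo N))" and irr: "irrefl (parcs (topo N))"
    and conn: "\<And>u v. u \<in> pverts (topo N) \<Longrightarrow> v \<in> pverts (topo N) \<Longrightarrow> (u, v) \<in> (parcs (topo N))\<^sup>*"
    and inj: "\<And>v. v \<in> pverts (topo N) \<Longrightarrow> inj_on (port N v) (nbrs N v)"
  shows "network N"
proof -
  have fina: "finite (parcs (topo N))" using fin arcs by (meson finite_SigmaI finite_subset)
  interpret pair_graph "topo N"
    by unfold_locales (use arcs sym irr fin fina in \<open>auto simp: irrefl_def symmetric_def\<close>)
  have "u \<rightarrow>\<^sup>*\<^bsub>with_proj (topo N)\<^esub> v" if u: "u \<in> pverts (topo N)" and v: "v \<in> pverts (topo N)" for u v
    using conn[OF u v] u
  proof (induction rule: rtrancl_induct)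
    case (step y z)
    then show ?case using reachable_adj_trans by auto
  qed auto
  then have "strongly_connected (with_proj (topo N))"
    using ne by (auto simp: strongly_connected_def)
  then have "connected (with_proj (topo N))"
    using reachable_mk_symmetricI by (auto simp: connected_def strongly_connected_def mk_symmetric_def)
  then show ?thesis unfolding network_def using inj pair_graph_axioms by blast
qed

text \<open>Arcs are symmetric, so connectedness is strong connectedness and a property passed on
  along arcs spreads everywhere. Connectivity enters the later arguments only in this form.\<close>

lemma network_induct:
  assumes N: "network N" and u: "u \<in> pverts (topo N)" "P u"
    and step: "\<And>v w. (v, w) \<in> parcs (topo N) \<Longrightarrow> P v \<Longrightarrow> P w"
    and w: "w \<in> pverts (topo N)"
  shows "P w"
proof -
  interpret pair_graph "topo N" using N by (simp add: network_def)
  have "strongly_connected (with_proj (topo N))"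
    using N symmetric_connected_imp_strongly_connected[OF sym_arcs] by (simp add: network_def)
  then have "u \<rightarrow>\<^sup>*\<^bsub>with_proj (topo N)\<^esub> w" using u w by (auto simp: strongly_connected_def)
  then show ?thesis
    by (induction rule: reachable_induct) (use u step in auto)
qed

lemma mem_ports: "v \<in> nbrs N u \<Longrightarrow> port N u v \<in> ports N u"
  by (simp add: ports_def)

lemma finite_ports: "network N \<Longrightarrow> finite (ports N u)"
proof -
  assume "network N"
  then have "finite (snd ` parcs (topo N))" using networkD(2) by blast
  moreover have "nbrs N u \<subseteq> snd ` parcs (topo N)" by (force simp: nbrs_def)
  ultimately show ?thesis by (auto simp: ports_def dest: finite_subset)
qed

section \<open>Attempted and successful moves; existence of executions\<close>

lemma crossers_unique:
  assumes "network N" "i \<in> crossers N k c out u v" "i \<in> crossers N k c out u' v'"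
  shows "u = u'" "v = v'"
  using assms networkD(7)[OF assms(1)] by (auto simp: crossers_def present_def)

lemma admissible_subset: "admissible d X M \<Longrightarrow> M \<subseteq> (\<Union>u v. X u v)"
  by (cases d) auto

text \<open>The adversary may choose the direction but cannot block both. This is used twice: a
  rotor-router never freezes, and a round without moves is a round without attempts.\<close>

lemma admissible_progress:
  assumes "admissible d X M" "X u v \<noteq> {}"
  shows "\<exists>i\<in>M. i \<in> X u v \<union> X v u"
proof (cases d)
  case Full_Duplex
  then show ?thesis using assms by auto
next
  case Half_Duplex
  then have "X u v \<subseteq> M \<or> X v u \<noteq> {} \<and> X v u \<subseteq> M" using assms by auto
  then show ?thesis using assms(2) by blast
qed

text \<open>In the half-duplex case, contended links are crossed towards the larger endpoint.\<close>

lemma admissible_exists: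
  fixes X :: "node \<Rightarrow> node \<Rightarrow> agent set"
  assumes disj: "\<And>i u v u' v'. i \<in> X u v \<Longrightarrow> i \<in> X u' v' \<Longrightarrow> u = u' \<and> v = v'"
    and loop: "\<And>u. X u u = {}"
  shows "\<exists>M. admissible d X M"
proof (cases d)
  case Full_Duplex
  then show ?thesis by auto
next
  case Half_Duplex
  define M where "M = {i. \<exists>u v. i \<in> X u v \<and> (u < v \<or> X v u = {})}"
  have win: "X u v \<subseteq> M \<and> X v u \<inter> M = {}" if "u < v" "X u v \<noteq> {}" for u v
  proof -
    have "i \<notin> M" if "i \<in> X v u" for i
    proof
      assume "i \<in> M"
      then obtain u' v' where "i \<in> X u' v'" "u' < v' \<or> X v' u' = {}" unfolding M_def by blast
      moreover have "u' = v" "v' = u" using disj[OF \<open>i \<in> X u' v'\<close> that] by auto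
      ultimately show False using \<open>u < v\<close> \<open>X u v \<noteq> {}\<close> by auto
    qed
    then show ?thesis using \<open>u < v\<close> unfolding M_def by blast
  qed
  have free: "X u v \<subseteq> M" if "X v u = {}" for u v
    using that unfolding M_def by blast
  have "X u v \<subseteq> M \<and> X v u \<inter> M = {} \<or> X v u \<noteq> {} \<and> X v u \<subseteq> M \<and> X u v \<inter> M = {}"
    if "X u v \<noteq> {}" for u v
  proof (cases "X v u = {}")
    case True
    then show ?thesis using free by blast
  next
    case False
    have "u \<noteq> v" using that loop by auto
    then consider "u < v" | "v < u" by linarith
    then show ?thesis using win that False by cases blast+
  qed
  moreover have "M \<subseteq> (\<Union>u v. X u v)" unfolding M_def by blast
  ultimately have "admissible d X M" using Half_Duplex by simp
  then show ?thesis by blast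
qed

lemma act_static:
  "act A N k i (c, out) = (c1, out1) \<Longrightarrow> pos c1 = pos c \<and> inc c1 = inc c"
  by (auto simp: act_def Let_def split: prod.splits)

lemma fold_act_static:
  "fold (act A N k) xs (c, out) = (c1, out1) \<Longrightarrow> pos c1 = pos c \<and> inc c1 = inc c"
proof (induction xs arbitrary: c out)
  case (Cons x xs)
  obtain c0 out0 where a: "act A N k x (c, out) = (c0, out0)" by fastforce
  with Cons have "fold (act A N k) xs (c0, out0) = (c1, out1)" by simp
  then show ?case using Cons.IH act_static[OF a] by metis
qed simp

lemma round_step_exists:
  assumes N: "network N"
  shows "\<exists>c'. round_step d A N k c c'"
proof -
  obtain c1 out where f: "fold (act A N k) [0..<k] (c, \<lambda>_. None) = (c1, out)" by fastforce
  define X where "X = crossers N k c1 out"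
  obtain M where M: "admissible d X M"
  proof -
    have "\<exists>M. admissible d X M"
    proof (rule admissible_exists)
      show "X u u = {}" for u
        using networkD(6)[OF N] by (auto simp: X_def crossers_def nbrs_def)
    qed (use crossers_unique[OF N] in \<open>auto simp: X_def\<close>)
    then show ?thesis using that by blast
  qed
  \<comment> \<open>The description is well defined by \<open>crossers_unique\<close>: labels are
    locally distinct, so an attempt determines its target.\<close>
  define p where "p i = (if i \<in> M then THE v. i \<in> X (pos c i) v else pos c i)" for i
  define c' where "c' = c1\<lparr>pos := p, wb := tick \<circ> wb c1,
    inc := (\<lambda>i. if i \<in> M then Some (port N (p i) (pos c i)) else None)\<rparr>"
  have "i \<in> X (pos c i) (p i)" if iM: "i \<in> M" for i
  proof -
    obtain u v where iX: "i \<in> X u v" using admissible_subset[OF M] iM by blast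
    then have "u = pos c i"
      using fold_act_static[OF f] by (auto simp: X_def crossers_def present_def)
    moreover have "p i = v"
      using iM iX calculation crossers_unique(2)[OF N] unfolding p_def X_def by auto
    ultimately show ?thesis using iX by simp
  qed
  then have "round_step d A N k c c'"
    unfolding round_step_def
    by (intro exI[of _ "[0..<k]"] exI[of _ M] exI[of _ c1] exI[of _ out])
       (use f M in \<open>auto simp: c'_def X_def p_def atLeast0LessThan\<close>)
  then show ?thesis by blast
qed

lemma round_step_moves:
  assumes N: "network N" and r: "round_step d A N k c c'" and i: "i < k"
  shows "pos c' i = pos c i \<and> inc c' i = None \<or>
    (pos c i, pos c' i) \<in> parcs (topo N) \<and> inc c' i = Some (port N (pos c' i) (pos c i))"
  using r i unfolding round_step_def by (fastforce simp: crossers_def nbrs_def split: if_splits)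

definition wellplaced :: "network \<Rightarrow> nat \<Rightarrow> config \<Rightarrow> bool" where
  "wellplaced N k c \<longleftrightarrow>
     (\<forall>i<k. pos c i \<in> pverts (topo N) \<and> set_option (inc c i) \<subseteq> ports N (pos c i))"

lemma wellplaced_step:
  assumes N: "network N" and r: "round_step d A N k c c'" and w: "wellplaced N k c"
  shows "wellplaced N k c'"
  unfolding wellplaced_def
proof (intro allI impI)
  fix i assume i: "i < k"
  show "pos c' i \<in> pverts (topo N) \<and> set_option (inc c' i) \<subseteq> ports N (pos c' i)"
    using round_step_moves[OF N r i] w i networkD(4,5)[OF N]
    by (auto simp: wellplaced_def nbrs_def intro!: mem_ports)
qed

text \<open>\<open>quiescent\<close> quantifies over all executions, so it provides a frozen suffix
  only once some execution is known to exist.\<close>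

lemma execution_exists:
  assumes N: "network N" and c: "initial N k gos c"
  shows "\<exists>e. execution d A N k gos e"
proof -
  have "\<exists>e. \<forall>t. (t = 0 \<longrightarrow> e t = c) \<and> round_step d A N k (e t) (e (Suc t))"
    by (rule dependent_nat_choice) (use round_step_exists[OF N] in auto)
  then show ?thesis using c unfolding execution_def by metis
qed

lemma execution_wellplaced:
  assumes "network N" "execution d A N k gos e"
  shows "wellplaced N k (e t)"
proof (induction t)
  case 0
  then show ?case using assms(2) by (auto simp: execution_def initial_def wellplaced_def)
next
  case (Suc t)
  then show ?case using wellplaced_step assms by (meson execution_def)
qed

section \<open>The persistent rotor-router\<close>

text \<open>
  The first component of the whiteboard is a rotor. A new agent at a node (one that has just arrived,
  or whose state is not a label of the node) commits to the link selected by the rotor and advances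
  it; a committed agent keeps trying the link stored in its state until it gets through.
\<close>

definition rotor :: algorithm where
  "rotor s others P l b =
     (if P = {} then (s, b, None)
      else if l = None \<and> s \<in> P then (s, b, Some s)
      else let p = sorted_list_of_set P ! (fst b mod card P) in (p, (Suc (fst b), snd b), Some p))"

text \<open>At a node with links, these are the agents that reach the last branch of
  \<open>rotor\<close>.\<close>

definition fresh :: "network \<Rightarrow> config \<Rightarrow> agent \<Rightarrow> bool" where
  "fresh N c i \<longleftrightarrow> inc c i \<noteq> None \<or> st c i \<notin> ports N (pos c i)"

definition link :: "network \<Rightarrow> node \<Rightarrow> nat \<Rightarrow> label" where
  "link N u m = sorted_list_of_set (ports N u) ! (m mod card (ports N u))"

lemma link_mem_ports: "network N \<Longrightarrow> ports N u \<noteq> {} \<Longrightarrow> link N u m \<in> ports N u"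
  using finite_ports[of N u] nth_mem[of "m mod card (ports N u)" "sorted_list_of_set (ports N u)"]
  by (auto simp: link_def card_gt_0_iff)

lemma link_recurrent:
  assumes N: "network N" and p: "p \<in> ports N u"
  shows "\<exists>m\<ge>B. link N u m = p"
proof -
  let ?P = "ports N u"
  have fin: "finite ?P" by (rule finite_ports[OF N])
  then have "p \<in> set (sorted_list_of_set ?P)" using p by simp
  then obtain j where j: "j < card ?P" "sorted_list_of_set ?P ! j = p"
    using fin by (metis in_set_conv_nth length_sorted_list_of_set)
  \<comment> \<open>The witness adds \<open>B\<close> full turns to the index \<open>j\<close>; a
    turn has at least one step because \<open>j < card ?P\<close>.\<close>
  have "j + B * card ?P \<ge> B" using j(1) by (cases "card ?P") auto
  moreover have "link N u (j + B * card ?P) = p" using j by (simp add: link_def)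
  ultimately show ?thesis by blast
qed

text \<open>Invariant for a prefix of the acting order, always compared with the start of the round.
  This comparison suffices because an agent acts once, so its state and freshness are still the
  original ones at its turn. Counters advance by one, hence skip no value, and the last clause can
  charge each value to the fresh agent that consumed it.\<close>

lemma fold_act_rotor:
  assumes N: "network N"
  assumes "fold (act rotor N k) xs (c, \<lambda>_. None) = (c1, out)" "distinct xs" "set xs \<subseteq> {..<k}"
  shows "(\<forall>i. i \<notin> set xs \<longrightarrow> st c1 i = st c i) \<and>
    (\<forall>i\<in>set xs. ports N (pos c i) \<noteq> {} \<longrightarrow>
       out i = Some (st c1 i) \<and> st c1 i \<in> ports N (pos c i) \<and>
       (\<not> fresh N c i \<longrightarrow> st c1 i = st c i) \<and>
       (fresh N c i \<longrightarrow> fst (wb c (pos c i)) < fst (wb c1 (pos c i)))) \<and>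
    (\<forall>u. fst (wb c u) \<le> fst (wb c1 u)) \<and>
    (\<forall>u m. ports N u \<noteq> {} \<longrightarrow> fst (wb c u) \<le> m \<longrightarrow> m < fst (wb c1 u) \<longrightarrow>
       (\<exists>i\<in>set xs. pos c i = u \<and> fresh N c i \<and> st c1 i = link N u m))"
  using assms(2-)
proof (induction xs arbitrary: c1 out rule: rev_induct)
  case Nil
  then show ?case by auto
next
  case (snoc x xs)
  obtain c0 out0 where f: "fold (act rotor N k) xs (c, \<lambda>_. None) = (c0, out0)" by fastforce
  have x: "x \<notin> set xs" "distinct xs" "set xs \<subseteq> {..<k}" using snoc.prems by auto
  note IH = snoc.IH[OF f x(2,3)]
  note IH1 = IH[THEN conjunct1, rule_format]
    and IH2 = IH[THEN conjunct2, THEN conjunct1, rule_format]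
    and IH3 = IH[THEN conjunct2, THEN conjunct2, THEN conjunct1, rule_format]
    and IH4 = IH[THEN conjunct2, THEN conjunct2, THEN conjunct2, rule_format]
  have stat: "pos c0 = pos c" "inc c0 = inc c" using fold_act_static[OF f] by auto
  have stx: "st c0 x = st c x" by (rule IH1[OF x(1)])
  define u where "u = pos c x"
  have a: "act rotor N k x (c0, out0) = (c1, out)" using snoc.prems f by simp
  show ?case
  proof (cases "ports N u = {}")
    case True
    then have "st c1 = st c0" "out = out0(x := None)" "wb c1 = wb c0"
      using a by (auto simp: act_def Let_def rotor_def stat u_def split: prod.splits)
    then show ?thesis using IH True x by (auto simp: u_def)
  next
    case ne: False
    show ?thesis
    proof (cases "fresh N c x")
      case False
      then have "st c1 = st c0" "out = out0(x := Some (st c x))" "wb c1 = wb c0"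
        using a ne stx
        by (auto simp: act_def Let_def rotor_def stat u_def fresh_def split: prod.splits)
      then show ?thesis using IH False x stx by (auto simp: u_def fresh_def)
    next
      case True
      let ?p = "link N u (fst (wb c0 u))"
      have e: "st c1 = (st c0)(x := ?p)" "out = out0(x := Some ?p)"
        "wb c1 = (wb c0)(u := (Suc (fst (wb c0 u)), snd (wb c0 u)))"
        using a ne True stx
        by (auto simp: act_def Let_def rotor_def stat u_def fresh_def link_def split: prod.splits)
      have p: "?p \<in> ports N u" by (rule link_mem_ports[OF N ne])
      have ctr: "fst (wb c1 v) = (if v = u then Suc (fst (wb c0 u)) else fst (wb c0 v))" for v
        by (simp add: e)
      have st1: "st c1 i = (if i = x then ?p else st c0 i)" for i by (simp add: e)
      have out1: "out i = (if i = x then Some ?p else out0 i)" for i by (simp add: e)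
      have "\<exists>i\<in>set (xs @ [x]). pos c i = v \<and> fresh N c i \<and> st c1 i = link N v m"
        if v: "ports N v \<noteq> {}" "fst (wb c v) \<le> m" "m < fst (wb c1 v)" for v m
      \<comment> \<open>The value consumed just now is charged to \<open>x\<close>; any other value
        was passed before \<open>x\<close> acted.\<close>
      proof (cases "v = u \<and> m = fst (wb c0 u)")
        case True
        then show ?thesis using \<open>fresh N c x\<close> by (auto simp: st1 u_def)
      next
        case False
        then have "m < fst (wb c0 v)" using v(3) by (auto simp: ctr split: if_splits)
        then obtain i where "i \<in> set xs" "pos c i = v" "fresh N c i" "st c0 i = link N v m"
          using IH4[OF v(1,2)] by blast
        then show ?thesis using x by (auto simp: st1)
      qed
      moreover have "fst (wb c v) \<le> fst (wb c1 v)" for v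
        using IH3 by (auto simp: ctr intro: le_SucI)
      moreover have "st c1 i = st c i" if "i \<notin> set (xs @ [x])" for i
        using IH1 that by (auto simp: st1)
      moreover have "out i = Some (st c1 i) \<and> st c1 i \<in> ports N (pos c i) \<and>
          (\<not> fresh N c i \<longrightarrow> st c1 i = st c i) \<and>
          (fresh N c i \<longrightarrow> fst (wb c (pos c i)) < fst (wb c1 (pos c i)))"
        if "i \<in> set (xs @ [x])" "ports N (pos c i) \<noteq> {}" for i
      proof (cases "i = x")
        case True
        have "fst (wb c u) < fst (wb c1 u)" using IH3 by (auto simp: ctr less_Suc_eq_le)
        then show ?thesis using True p \<open>fresh N c x\<close> by (auto simp: st1 out1 u_def)
      next
        case False
        then have "i \<in> set xs" using that by auto
        then have "out0 i = Some (st c0 i) \<and> st c0 i \<in> ports N (pos c i) \<and>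
          (\<not> fresh N c i \<longrightarrow> st c0 i = st c i) \<and>
          (fresh N c i \<longrightarrow> fst (wb c (pos c i)) < fst (wb c0 (pos c i)))" using IH2 that by auto
        moreover have "fst (wb c0 (pos c i)) \<le> fst (wb c1 (pos c i))" by (simp add: ctr)
        ultimately show ?thesis using False by (auto simp: st1 out1)
      qed
      ultimately show ?thesis by (intro conjI allI ballI impI) auto
    qed
  qed
qed

text \<open>\<open>tick\<close> advances only the timers, so the rotors survive the end of the round
  unchanged. The last claim rests on \<open>admissible_progress\<close>: an agent at a node with
  links always attempts a move, and then some agent, perhaps another one, succeeds.\<close>

lemma rotor_round:
  assumes N: "network N" and r: "round_step d rotor N k c c'"
  shows "\<And>i. i < k \<Longrightarrow> ports N (pos c i) \<noteq> {} \<Longrightarrow> st c' i \<in> ports N (pos c i)"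
    and "\<And>i. i < k \<Longrightarrow> ports N (pos c i) \<noteq> {} \<Longrightarrow> \<not> fresh N c i \<Longrightarrow> st c' i = st c i"
    and "\<And>i. i < k \<Longrightarrow> ports N (pos c i) \<noteq> {} \<Longrightarrow> fresh N c i \<Longrightarrow>
           fst (wb c (pos c i)) < fst (wb c' (pos c i))"
    and "\<And>u. fst (wb c u) \<le> fst (wb c' u)"
    and "\<And>u m. ports N u \<noteq> {} \<Longrightarrow> fst (wb c u) \<le> m \<Longrightarrow> m < fst (wb c' u) \<Longrightarrow>
           \<exists>i<k. pos c i = u \<and> fresh N c i \<and> st c' i = link N u m"
    and "\<And>i. i < k \<Longrightarrow> pos c' i \<noteq> pos c i \<Longrightarrow> st c' i = port N (pos c i) (pos c' i)"
    and "\<And>i. i < k \<Longrightarrow> ports N (pos c i) \<noteq> {} \<Longrightarrow> \<exists>j<k. pos c' j \<noteq> pos c j"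
proof -
  obtain ord M c1 out where ord: "distinct ord" "set ord = {..<k}"
    and f: "fold (act rotor N k) ord (c, \<lambda>_. None) = (c1, out)"
    and M: "admissible d (crossers N k c1 out) M"
    and mv: "\<And>i. i < k \<Longrightarrow> if i \<in> M
           then i \<in> crossers N k c1 out (pos c i) (pos c' i) \<and>
                inc c' i = Some (port N (pos c' i) (pos c i))
           else pos c' i = pos c i \<and> inc c' i = None"
    and c': "st c' = st c1" "wb c' = tick \<circ> wb c1"
    using r unfolding round_step_def by metis
  have stat: "pos c1 = pos c" using fold_act_static[OF f] by simp
  have ctr: "fst (wb c' u) = fst (wb c1 u)" for u by (simp add: c' tick_def)
  note F = fold_act_rotor[OF N f ord(1), unfolded ord(2), OF order_refl]
  note F2 = F[THEN conjunct2, THEN conjunct1, rule_format]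
    and F3 = F[THEN conjunct2, THEN conjunct2, THEN conjunct1, rule_format]
    and F4 = F[THEN conjunct2, THEN conjunct2, THEN conjunct2, rule_format]
  show "st c' i \<in> ports N (pos c i)" if "i < k" "ports N (pos c i) \<noteq> {}" for i
    using F2 that by (auto simp: c')
  show "st c' i = st c i" if "i < k" "ports N (pos c i) \<noteq> {}" "\<not> fresh N c i" for i
    using F2 that by (auto simp: c')
  show "fst (wb c (pos c i)) < fst (wb c' (pos c i))"
    if "i < k" "ports N (pos c i) \<noteq> {}" "fresh N c i" for i
    using F2 that by (auto simp: ctr)
  show "fst (wb c u) \<le> fst (wb c' u)" for u
    using F3 by (auto simp: ctr)
  show "\<exists>i<k. pos c i = u \<and> fresh N c i \<and> st c' i = link N u m"
    if "ports N u \<noteq> {}" "fst (wb c u) \<le> m" "m < fst (wb c' u)" for u m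
    using F4[OF that(1,2)] that(3) by (auto simp: ctr c'(1))
  show "st c' i = port N (pos c i) (pos c' i)" if i: "i < k" "pos c' i \<noteq> pos c i" for i
  proof -
    have cr: "i \<in> crossers N k c1 out (pos c i) (pos c' i)" using mv[OF i(1)] i(2) by (auto split: if_splits)
    then have "ports N (pos c i) \<noteq> {}" by (auto simp: crossers_def ports_def)
    then have "out i = Some (st c1 i)" using F2 i by auto
    then show ?thesis using cr by (simp add: crossers_def c')
  qed
  show "\<exists>j<k. pos c' j \<noteq> pos c j" if i: "i < k" "ports N (pos c i) \<noteq> {}" for i
  proof -
    have o: "out i = Some (st c1 i)" "st c1 i \<in> ports N (pos c i)" using F2 i by auto
    then obtain v where v: "v \<in> nbrs N (pos c i)" "st c1 i = port N (pos c i) v"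
      by (auto simp: ports_def)
    have "i \<in> crossers N k c1 out (pos c i) v"
      using v i o by (simp add: crossers_def present_def stat)
    then obtain j where jM: "j \<in> M" and j: "\<exists>u w. j \<in> crossers N k c1 out u w"
      using admissible_progress[OF M] by blast
    then have jk: "j < k" by (auto simp: crossers_def present_def)
    then have "j \<in> crossers N k c1 out (pos c j) (pos c' j)" using mv[OF jk] jM by simp
    then have "pos c' j \<noteq> pos c j" using networkD(6)[OF N] by (auto simp: crossers_def nbrs_def)
    then show ?thesis using jk by blast
  qed
qed

section \<open>Every link is crossed infinitely often\<close>

definition crossed :: "nat \<Rightarrow> (nat \<Rightarrow> config) \<Rightarrow> nat \<Rightarrow> node \<Rightarrow> node \<Rightarrow> bool" where
  "crossed k e t u v \<longleftrightarrow> (\<exists>i<k. pos (e t) i = u \<and> pos (e (Suc t)) i = v)"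

lemma nondecreasing_passes:
  fixes f :: "nat \<Rightarrow> nat"
  assumes "f t0 \<le> m" "m < f t1" "t0 \<le> t1"
  shows "\<exists>t\<ge>t0. f t \<le> m \<and> m < f (Suc t)"
  using assms(3,1,2)
proof (induction t1 rule: dec_induct)
  case (step n)
  then show ?case by (cases "m < f n") (auto simp: not_less)
qed auto

text \<open>
  Every pass of the rotor over the label of \<open>(u, v)\<close> commits one more agent to this link. If the link
  were no longer crossed, such agents would pile up at \<open>u\<close>, but there are only \<open>k\<close> agents.
\<close>

lemma rotor_crosses_next:
  assumes N: "network N" and step: "\<And>t. round_step d rotor N k (e t) (e (Suc t))"
    and arc: "(u, v) \<in> parcs (topo N)"
    and visits: "\<And>T. \<exists>t\<ge>T. \<exists>i<k. pos (e t) i = u \<and> fresh N (e t) i"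
  shows "\<exists>t\<ge>T. crossed k e t u v"
proof (rule ccontr)
  assume "\<not> ?thesis"
  then have no: "\<not> crossed k e t u v" if "t \<ge> T" for t using that by blast
  let ?p = "port N u v"
  have v: "v \<in> nbrs N u" using arc by (simp add: nbrs_def)
  then have p: "?p \<in> ports N u" "ports N u \<noteq> {}" by (auto intro: mem_ports dest: mem_ports)
  have uv: "u \<noteq> v" using arc networkD(6)[OF N] by auto
  \<comment> \<open>The agents piled up at \<open>u\<close>: committed to the link to
    \<open>v\<close> and not fresh.\<close>
  define W where "W t = {i. i < k \<and> pos (e t) i = u \<and> inc (e t) i = None \<and> st (e t) i = ?p}" for t
  have cardW: "card (W t) \<le> k" for t
    using card_mono[of "{..<k}" "W t"] by (auto simp: W_def)
  have finW: "finite (W t)" for t by (simp add: W_def)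
  \<comment> \<open>An agent holding \<open>?p\<close> could leave \<open>u\<close> only towards
    \<open>v\<close>, which is excluded from \<open>T\<close> on.\<close>
  have enter: "i \<in> W (Suc t)" if "t \<ge> T" "i < k" "pos (e t) i = u" "st (e (Suc t)) i = ?p" for t i
  proof -
    have "pos (e (Suc t)) i = u"
    proof (rule ccontr)
      assume m: "pos (e (Suc t)) i \<noteq> u"
      then have "?p = port N u (pos (e (Suc t)) i)"
        using rotor_round(6)[OF N step, of i t] that by auto
      moreover have "pos (e (Suc t)) i \<in> nbrs N u"
        using round_step_moves[OF N step that(2), of t] m that(3) by (auto simp: nbrs_def)
      ultimately have "pos (e (Suc t)) i = v" using networkD(7)[OF N] v by metis
      then show False using no[OF that(1)] that by (auto simp: crossed_def)
    qed
    then show ?thesis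
      using that round_step_moves[OF N step that(2), of t] networkD(6)[OF N] by (auto simp: W_def)
  qed
  have W_mono: "W t \<subseteq> W (Suc t)" if "t \<ge> T" for t
  proof
    fix i assume i: "i \<in> W t"
    then have "\<not> fresh N (e t) i" using p by (auto simp: W_def fresh_def)
    then have "st (e (Suc t)) i = ?p" using rotor_round(2)[OF N step, of i t] i p by (auto simp: W_def)
    then show "i \<in> W (Suc t)" using enter[OF that] i by (auto simp: W_def)
  qed
  \<comment> \<open>At \<open>s\<close> the pile is as large as it ever gets; the bound
    \<open>k\<close> makes a maximum exist. One more committed agent after \<open>s\<close> is the
    contradiction sought.\<close>
  obtain s where s: "s \<ge> T" and max: "\<And>t. t \<ge> T \<Longrightarrow> card (W t) \<le> card (W s)"
    using ex_has_greatest_nat[of "\<lambda>t. t \<ge> T" T "\<lambda>t. card (W t)" "Suc k"] cardW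
    by (metis le_imp_less_Suc order_refl)
  let ?f = "\<lambda>t. fst (wb (e t) u)"
  have f_mono: "?f t \<le> ?f t'" if "t \<le> t'" for t t'
    using that rotor_round(4)[OF N step] by (rule lift_Suc_mono_le[rotated])
  have unbounded: "\<exists>t\<ge>s. n + ?f s \<le> ?f t" for n
  proof (induction n)
    case (Suc n)
    then obtain t where t: "t \<ge> s" "n + ?f s \<le> ?f t" by blast
    obtain t' i where t': "t' \<ge> t" "i < k" "pos (e t') i = u" "fresh N (e t') i" using visits by blast
    have "?f t' < ?f (Suc t')" using rotor_round(3)[OF N step, of i t'] t' p by auto
    then show ?case using t t' f_mono[OF t'(1)] by (intro exI[of _ "Suc t'"]) auto
  qed auto
  \<comment> \<open>A counter value not yet consumed at time \<open>s\<close> that selects the link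
    to \<open>v\<close>. The recurrent fresh visits drive the counter past it at some later round
    \<open>t\<close>.\<close>
  obtain m where m: "m \<ge> ?f s" "link N u m = ?p" using link_recurrent[OF N p(1)] by blast
  obtain t1 where t1: "t1 \<ge> s" "Suc m + ?f s \<le> ?f t1" using unbounded by blast
  obtain t where t: "t \<ge> s" "?f t \<le> m" "m < ?f (Suc t)"
    using nondecreasing_passes[of ?f s m t1] m t1 by auto
  obtain i where i: "i < k" "pos (e t) i = u" "fresh N (e t) i" "st (e (Suc t)) i = ?p"
    using rotor_round(5)[OF N step p(2) t(2,3)] m(2) by auto
  have tT: "t \<ge> T" using t s by simp
  \<comment> \<open>The agent that consumes \<open>m\<close> is fresh, hence outside the pile until
    now, so the pile grows strictly.\<close>
  have "i \<notin> W t" using i p by (auto simp: W_def fresh_def)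
  then have "W t \<subset> W (Suc t)" using W_mono[OF tT] enter[OF tT i(1,2,4)] by blast
  then have "card (W t) < card (W (Suc t))" by (rule psubset_card_mono[OF finW])
  moreover have "card (W s) \<le> card (W t)"
  proof -
    have "W s \<subseteq> W t" using t(1)
    proof (induction t rule: dec_induct)
      case (step n)
      then show ?case using W_mono[of n] s by fastforce
    qed auto
    then show ?thesis using finW by (simp add: card_mono)
  qed
  ultimately show False using max[of "Suc t"] tT by auto
qed

text \<open>Some agent moves in every round and there are finitely many arcs, so one arc is crossed
  infinitely often. Each crossing brings a fresh agent to its head, and
  \<open>rotor_crosses_next\<close> then makes all arcs leaving that node recurrent; connectivity
  carries this to every node.\<close>

lemma rotor_crosses_every_arc:
  assumes N: "network N" and ex: "execution d rotor N k gos e" and k: "k > 0"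
    and arc: "(u, v) \<in> parcs (topo N)"
  shows "\<exists>t\<ge>T. crossed k e t u v"
proof -
  have step: "\<And>t. round_step d rotor N k (e t) (e (Suc t))" using ex by (simp add: execution_def)
  have next_arc: "\<forall>T. \<exists>t\<ge>T. crossed k e t y z"
    if xy: "(x, y) \<in> parcs (topo N)" "\<forall>T. \<exists>t\<ge>T. crossed k e t x y" and yz: "(y, z) \<in> parcs (topo N)"
    for x y z
  proof (intro allI, rule rotor_crosses_next[of N d k e y z, OF N step yz])
    fix T
    obtain t i where t: "t \<ge> T" "i < k" "pos (e t) i = x" "pos (e (Suc t)) i = y"
      using xy(2) unfolding crossed_def by blast
    moreover have "x \<noteq> y" using xy(1) networkD(6)[OF N] by auto
    ultimately have "fresh N (e (Suc t)) i"
      using round_step_moves[OF N step, of i t] by (auto simp: fresh_def)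
    then show "\<exists>t\<ge>T. \<exists>i<k. pos (e t) i = y \<and> fresh N (e t) i"
      using t by (intro exI[of _ "Suc t"]) auto
  qed
  have move: "\<exists>a \<in> parcs (topo N). crossed k e t (fst a) (snd a)" for t
  proof -
    let ?P = "\<lambda>x. ports N x \<noteq> {}"
    have 0: "pos (e t) 0 \<in> pverts (topo N)"
      using execution_wellplaced[OF N ex, of t] k by (auto simp: wellplaced_def)
    have "?P (pos (e t) 0)"
    proof (rule ccontr)
      assume none: "\<not> ?P (pos (e t) 0)"
      \<comment> \<open>A node without links would be the whole network, but \<open>u\<close> has a
        link.\<close>
      have "u = pos (e t) 0"
      proof (rule network_induct[of N _ "\<lambda>y. y = pos (e t) 0", OF N 0])
        show "w = pos (e t) 0" if "(x, w) \<in> parcs (topo N)" "x = pos (e t) 0" for x w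
          using none that by (auto simp: ports_def nbrs_def)
      qed (use networkD(3)[OF N arc] in auto)
      then show False using none arc by (auto simp: ports_def nbrs_def)
    qed
    then obtain j where "j < k" "pos (e (Suc t)) j \<noteq> pos (e t) j"
      using rotor_round(7)[OF N step[of t], of 0] k by auto
    then show ?thesis using round_step_moves[OF N step, of j t]
      by (intro bexI[of _ "(pos (e t) j, pos (e (Suc t)) j)"]) (auto simp: crossed_def)
  qed
  obtain a where a: "a \<in> parcs (topo N)" "infinite {t. crossed k e t (fst a) (snd a)}"
    using pigeonhole_infinite_rel[of UNIV "parcs (topo N)" "\<lambda>t a. crossed k e t (fst a) (snd a)"]
      networkD(2)[OF N] move by auto
  obtain x y where xy: "(x, y) \<in> parcs (topo N)" "\<forall>T. \<exists>t\<ge>T. crossed k e t x y"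
    using a by (cases a) (auto simp: infinite_nat_iff_unbounded_le)
  have "\<forall>z. (y, z) \<in> parcs (topo N) \<longrightarrow> (\<forall>T. \<exists>t\<ge>T. crossed k e t y z)"
    using next_arc[OF xy] by blast
  moreover have "\<forall>z. (w, z) \<in> parcs (topo N) \<longrightarrow> (\<forall>T. \<exists>t\<ge>T. crossed k e t w z)"
    if "(y', w) \<in> parcs (topo N)"
      "\<forall>z. (y', z) \<in> parcs (topo N) \<longrightarrow> (\<forall>T. \<exists>t\<ge>T. crossed k e t y' z)" for y' w
    using next_arc that by blast
  ultimately have "\<forall>z. (u, z) \<in> parcs (topo N) \<longrightarrow> (\<forall>T. \<exists>t\<ge>T. crossed k e t u z)"
    using network_induct[OF N networkD(4)[OF N xy(1)],
        of "\<lambda>w. \<forall>z. (w, z) \<in> parcs (topo N) \<longrightarrow> (\<forall>T. \<exists>t\<ge>T. crossed k e t w z)" u]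
      networkD(3)[OF N arc] by blast
  then show ?thesis using arc by blast
qed

section \<open>Propagation of gossip\<close>

text \<open>Boards and memories only grow. Hence, whatever the acting order, an agent reads at least
  what its board held at the start of the round and leaves there at least what it knew.\<close>

lemma fold_act_gossip:
  assumes "fold (act A N k) xs (c, out0) = (c1, out)" "set xs \<subseteq> {..<k}"
  shows "(\<forall>v. posted c v \<subseteq> posted c1 v) \<and> (\<forall>i. i < k \<longrightarrow> known c i \<subseteq> known c1 i) \<and>
    (\<forall>i\<in>set xs. posted c (pos c i) \<subseteq> known c1 i \<and> known c i \<subseteq> posted c1 (pos c i))"
  using assms
proof (induction xs arbitrary: c1 out rule: rev_induct)
  case (snoc x xs)
  obtain c0 out1 where f: "fold (act A N k) xs (c, out0) = (c0, out1)" by fastforce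
  have x: "x < k" "set xs \<subseteq> {..<k}" using snoc.prems by auto
  note IH = snoc.IH[OF f x(2)]
  have stat: "pos c0 = pos c" using fold_act_static[OF f] by simp
  let ?K = "posted c0 (pos c x) \<union> (\<Union>j \<in> present k c0 (pos c x). known c0 j)"
  have a: "act A N k x (c0, out1) = (c1, out)" using snoc.prems f by simp
  then have e: "posted c1 = (posted c0)(pos c x := ?K)" "known c1 = (known c0)(x := ?K)"
    by (auto simp: act_def Let_def stat split: prod.splits)
  have "known c0 x \<subseteq> ?K" using x by (auto simp: present_def stat)
  then have "\<forall>v. posted c0 v \<subseteq> posted c1 v" "\<forall>i. known c0 i \<subseteq> known c1 i"
    "posted c0 (pos c x) \<subseteq> known c1 x" "known c0 x \<subseteq> posted c1 (pos c x)"
    unfolding e by auto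
  with IH x show ?case
    by (simp only: set_append list.set ball_Un ball_simps simp_thms) (meson order_trans)
qed simp

lemma round_step_gossip:
  assumes "round_step d A N k c c'"
  shows "posted c v \<subseteq> posted c' v"
    and "i < k \<Longrightarrow> known c i \<subseteq> known c' i"
    and "i < k \<Longrightarrow> posted c (pos c i) \<subseteq> known c' i"
    and "i < k \<Longrightarrow> known c i \<subseteq> posted c' (pos c i)"
proof -
  obtain ord c1 out where "set ord = {..<k}" "fold (act A N k) ord (c, \<lambda>_. None) = (c1, out)"
    "known c' = known c1" "posted c' = posted c1"
    using assms unfolding round_step_def by metis
  then show "posted c v \<subseteq> posted c' v" "i < k \<Longrightarrow> known c i \<subseteq> known c' i"
    "i < k \<Longrightarrow> posted c (pos c i) \<subseteq> known c' i" "i < k \<Longrightarrow> known c i \<subseteq> posted c' (pos c i)"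
    using fold_act_gossip[of A N k ord c "\<lambda>_. None" c1 out] by auto
qed

text \<open>Recurrent crossings suffice, for any algorithm: the agent crossing from \<open>v\<close>
  to \<open>y\<close> acts at \<open>v\<close> before it moves, so it carries \<open>x\<close> along
  and posts it at \<open>y\<close> one round later.\<close>

lemma posted_everywhere:
  assumes N: "network N" and step: "\<And>t. round_step d A N k (e t) (e (Suc t))"
    and cross: "\<And>u v T. (u, v) \<in> parcs (topo N) \<Longrightarrow> \<exists>t\<ge>T. crossed k e t u v"
    and u: "u \<in> pverts (topo N)" "x \<in> posted (e s) u" and w: "w \<in> pverts (topo N)"
  shows "\<forall>\<^sub>F t in sequentially. x \<in> posted (e t) w"
proof -
  have mono: "x \<in> posted (e t) v \<Longrightarrow> t \<le> t' \<Longrightarrow> x \<in> posted (e t') v" for t t' v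
    using lift_Suc_mono_le[of "\<lambda>t. posted (e t) v" t t'] round_step_gossip(1)[OF step] by blast
  show ?thesis
  proof (rule network_induct[OF N u(1) _ _ w])
    show "\<forall>\<^sub>F t in sequentially. x \<in> posted (e t) u"
      using u(2) mono by (auto simp: eventually_sequentially)
    fix v y
    assume arc: "(v, y) \<in> parcs (topo N)" and v: "\<forall>\<^sub>F t in sequentially. x \<in> posted (e t) v"
    then obtain T where T: "x \<in> posted (e t) v" if "t \<ge> T" for t
      by (auto simp: eventually_sequentially)
    obtain t i where t: "t \<ge> T" "i < k" "pos (e t) i = v" "pos (e (Suc t)) i = y"
      using cross[OF arc, of T] unfolding crossed_def by blast
    have "x \<in> known (e (Suc t)) i" using round_step_gossip(3)[OF step t(2)] T t by blast
    then have "x \<in> posted (e (Suc (Suc t))) y" using round_step_gossip(4)[OF step t(2)] t(4) by blast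
    then show "\<forall>\<^sub>F t in sequentially. x \<in> posted (e t) y"
      using mono by (auto simp: eventually_sequentially)
  qed
qed

lemma self_stabilizing_rotor: "self_stabilizing d rotor"
  unfolding self_stabilizing_def
proof (intro allI impI)
  fix N k gos e i
  assume N: "network N" and ex: "execution d rotor N k gos e" and i: "i < k"
  have step: "\<And>t. round_step d rotor N k (e t) (e (Suc t))" and ini: "initial N k gos (e 0)"
    using ex by (simp_all add: execution_def)
  let ?V = "pverts (topo N)"
  have at: "pos (e t) j \<in> ?V" if "j < k" for j t
    using execution_wellplaced[OF N ex] that by (auto simp: wellplaced_def)
  have "\<forall>\<^sub>F t in sequentially. gos j \<in> posted (e t) v" if j: "j < k" and v: "v \<in> ?V" for j v
  proof (rule posted_everywhere[of N d rotor k e, OF N step _ _ _ v])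
    show "\<exists>t\<ge>T. crossed k e t x y" if "(x, y) \<in> parcs (topo N)" for x y T
      using rotor_crosses_every_arc[OF N ex _ that] i by auto
    show "pos (e 0) j \<in> ?V" by (rule at[OF j])
    show "gos j \<in> posted (e (Suc 0)) (pos (e 0) j)"
      using round_step_gossip(4)[OF step j] ini j by (auto simp: initial_def)
  qed
  \<comment> \<open>Finitely many nodes and agents: one time serves all of them, wherever agent
    \<open>i\<close> then stands.\<close>
  then have "\<forall>\<^sub>F t in sequentially. \<forall>v\<in>?V. \<forall>j\<in>{..<k}. gos j \<in> posted (e t) v"
    using networkD(1)[OF N] by (intro eventually_ball_finite ballI) auto
  then obtain t where t: "\<forall>v\<in>?V. \<forall>j\<in>{..<k}. gos j \<in> posted (e t) v"
    by (auto simp: eventually_sequentially)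
  then have "\<forall>j<k. gos j \<in> known (e (Suc t)) i"
    using round_step_gossip(3)[OF step i] at[OF i] by blast
  then show "\<exists>t. \<forall>j<k. gos j \<in> known (e t) i" by blast
qed

section \<open>Two copies of a quiescent network\<close>

text \<open>A convenient choice: connectedness is immediate, and naming each link by its far end
  leaves label \<open>v\<close> free at node \<open>v\<close>, ready for the joining link.\<close>

definition clique :: "nat \<Rightarrow> network" where
  "clique n = \<lparr>topo = \<lparr>pverts = {..<n}, parcs = {(u, v). u < n \<and> v < n \<and> u \<noteq> v}\<rparr>,
    port = (\<lambda>u v. v)\<rparr>"

text \<open>
  Node \<open>v\<close> of copy \<open>b \<in> {0, 1}\<close> of the clique is \<open>v + b * n\<close>; the copies are joined by a link between
  their nodes \<open>w\<close>, whose label \<open>w\<close> is not used by the links inside a copy.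
\<close>

definition double_clique :: "nat \<Rightarrow> node \<Rightarrow> network" where
  "double_clique n w = \<lparr>topo = \<lparr>pverts = {..<2 * n},
      parcs = {(u, v). u < 2 * n \<and> v < 2 * n \<and> u \<noteq> v \<and>
        (u div n = v div n \<or> u mod n = w \<and> v mod n = w)}\<rparr>,
    port = (\<lambda>u v. v mod n)\<rparr>"

lemma network_clique: "n > 0 \<Longrightarrow> network (clique n)"
proof (rule networkI)
  fix u v assume "u \<in> pverts (topo (clique n))" "v \<in> pverts (topo (clique n))"
  then show "(u, v) \<in> (parcs (topo (clique n)))\<^sup>*"
    by (cases "u = v") (auto simp: clique_def)
qed (auto simp: clique_def sym_def irrefl_def inj_on_def)

section \<open>Indexing of the copies, for nodes with base \<open>n\<close> and for agents with base
  \<open>k\<close>\<close>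

lemma copy_eq_iff:
  fixes i j b b' n :: nat
  assumes "i < n" "j < n"
  shows "i + b * n = j + b' * n \<longleftrightarrow> i = j \<and> b = b'"
proof
  assume eq: "i + b * n = j + b' * n"
  then have "(i + b * n) mod n = (j + b' * n) mod n" "(i + b * n) div n = (j + b' * n) div n"
    by auto
  then show "i = j \<and> b = b'" using assms by simp
qed simp

lemma copy_less: "i < n \<Longrightarrow> b < 2 \<Longrightarrow> i + b * n < 2 * (n :: nat)"
  by (auto dest: less_2_cases)

lemma copyE:
  assumes "x < 2 * (n :: nat)"
  obtains i b where "i < n" "b < 2" "x = i + b * n"
proof (rule that[of "x mod n" "x div n"])
  show "x mod n < n" using assms by (cases n) auto
  show "x div n < 2" using assms by (simp add: less_mult_imp_div_less)
qed simp

text \<open>The joining link touches only the copies of \<open>w\<close>, so elsewhere the doubling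
  is invisible locally.\<close>

lemma nbrs_double_clique:
  assumes "v < n" "v \<noteq> w" "b < 2"
  shows "nbrs (double_clique n w) (v + b * n) = (\<lambda>x. x + b * n) ` nbrs (clique n) v"
proof -
  have "x \<in> nbrs (double_clique n w) (v + b * n) \<longleftrightarrow> x \<in> (\<lambda>x. x + b * n) ` nbrs (clique n) v" for x
  proof (cases "x < 2 * n")
    case True
    then obtain y b' where x: "y < n" "b' < 2" "x = y + b' * n" by (rule copyE)
    then show ?thesis using assms copy_less[of v n b] copy_less[of y n b']
      by (auto simp: nbrs_def double_clique_def clique_def copy_eq_iff)
  next
    case False
    then show ?thesis using copy_less[OF _ assms(3)]
      by (auto simp: nbrs_def double_clique_def clique_def)
  qed
  then show ?thesis by blast
qed

lemma ports_double_clique: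
  assumes "v < n" "v \<noteq> w" "b < 2"
  shows "ports (double_clique n w) (v + b * n) = ports (clique n) v"
  unfolding ports_def nbrs_double_clique[OF assms]
  by (auto simp: nbrs_def double_clique_def clique_def image_iff)

lemma network_double_clique:
  assumes w: "w < n"
  shows "network (double_clique n w)"
proof (rule networkI)
  let ?A = "parcs (topo (double_clique n w))"
  have inside: "(x + b * n, y + b * n) \<in> ?A\<^sup>*" if "x < n" "y < n" "b < 2" for x y b
    using that copy_less[of x n b] copy_less[of y n b]
    by (cases "x = y") (auto simp: double_clique_def)
  have bridge: "(w + b * n, w + b' * n) \<in> ?A\<^sup>*" if "b < 2" "b' < 2" for b b'
    using that w copy_less[of w n b] copy_less[of w n b']
    by (cases "b = b'") (auto simp: double_clique_def)
  fix u v assume "u \<in> pverts (topo (double_clique n w))" "v \<in> pverts (topo (double_clique n w))"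
  then have "u < 2 * n" "v < 2 * n" by (auto simp: double_clique_def)
  then obtain x b y b' where "x < n" "b < 2" "u = x + b * n" "y < n" "b' < 2" "v = y + b' * n"
    by (metis copyE)
  then show "(u, v) \<in> ?A\<^sup>*"
    using inside[of x w b] bridge[of b b'] inside[of w y b'] w by auto
next
  show "pverts (topo (double_clique n w)) \<noteq> {}"
    using w by (auto simp: double_clique_def set_eq_iff intro!: exI[of _ 0])
next
  fix u
  show "inj_on (port (double_clique n w) u) (nbrs (double_clique n w) u)"
  proof (rule inj_onI)
    fix x y
    assume "x \<in> nbrs (double_clique n w) u" "y \<in> nbrs (double_clique n w) u"
      and "port (double_clique n w) u x = port (double_clique n w) u y"
    then have lt: "x < 2 * n" "y < 2 * n" "u < 2 * n" and ne: "u \<noteq> x" "u \<noteq> y"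
      and mods: "x mod n = y mod n"
      and adj: "u div n = x div n \<or> u mod n = w \<and> x mod n = w"
        "u div n = y div n \<or> u mod n = w \<and> y mod n = w"
      by (auto simp: nbrs_def double_clique_def)
    have divs: "x div n < 2" "y div n < 2" "u div n < 2"
      using lt by (simp_all add: less_mult_imp_div_less)
    have eqI: "a = b" if "a div n = b div n" "a mod n = b mod n" for a b
      using that by (metis div_mult_mod_eq)
    \<comment> \<open>If the two neighbours lay in different copies, one would be reached over the
      joining link, so both and \<open>u\<close> would be copies of \<open>w\<close>; the neighbour
      in the copy of \<open>u\<close> would then be \<open>u\<close> itself.\<close>
    have "x div n = y div n"
      using adj mods divs ne eqI[of u x] eqI[of u y] by (auto simp: less_2_cases_iff)
    then show "x = y" using mods by (rule eqI)
  qed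
qed (auto simp: double_clique_def sym_def irrefl_def)

text \<open>
  In copy \<open>b\<close>, agent \<open>i\<close> of \<open>C b\<close> is represented by agent \<open>i + b * k\<close>; agent \<open>j\<close> has gossip \<open>j\<close>.
\<close>

definition clones :: "nat \<Rightarrow> nat \<Rightarrow> node \<Rightarrow> (nat \<Rightarrow> config \<times> (agent \<Rightarrow> label option))
    \<Rightarrow> config \<Rightarrow> (agent \<Rightarrow> label option) \<Rightarrow> bool" where
  "clones n k w C c' out' \<longleftrightarrow> (\<forall>b<2.
     (\<forall>i<k. pos (fst (C b)) i < n \<and> pos (fst (C b)) i \<noteq> w \<and>
        pos c' (i + b * k) = pos (fst (C b)) i + b * n \<and>
        st c' (i + b * k) = st (fst (C b)) i \<and> inc c' (i + b * k) = inc (fst (C b)) i \<and>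
        out' (i + b * k) = snd (C b) i \<and> known c' (i + b * k) \<subseteq> {b * k..<b * k + k}) \<and>
     (\<forall>v<n. v \<noteq> w \<longrightarrow> wb c' (v + b * n) = wb (fst (C b)) v \<and>
        posted c' (v + b * n) \<subseteq> {b * k..<b * k + k}))"

lemma clonesD:
  assumes "clones n k w C c' out'" "b < 2"
  shows "i < k \<Longrightarrow> pos (fst (C b)) i < n" "i < k \<Longrightarrow> pos (fst (C b)) i \<noteq> w"
    and "i < k \<Longrightarrow> pos c' (i + b * k) = pos (fst (C b)) i + b * n"
    and "i < k \<Longrightarrow> st c' (i + b * k) = st (fst (C b)) i"
    and "i < k \<Longrightarrow> inc c' (i + b * k) = inc (fst (C b)) i"
    and "i < k \<Longrightarrow> out' (i + b * k) = snd (C b) i"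
    and "i < k \<Longrightarrow> known c' (i + b * k) \<subseteq> {b * k..<b * k + k}"
    and "v < n \<Longrightarrow> v \<noteq> w \<Longrightarrow> wb c' (v + b * n) = wb (fst (C b)) v"
    and "v < n \<Longrightarrow> v \<noteq> w \<Longrightarrow> posted c' (v + b * n) \<subseteq> {b * k..<b * k + k}"
  using assms unfolding clones_def by blast+

text \<open>Agents act one by one, so within a round the two copies get out of step; this is why
  \<open>C\<close> depends on \<open>b\<close>. Gossip is only bounded, not copied: each copy has
  its own, and the acting agent meets and reads nothing from the other one.\<close>

lemma act_clones:
  assumes cl: "clones n k w C c' out'" and b: "b < 2" and i: "i < k"
    and act': "act A (double_clique n w) (2 * k) (i + b * k) (c', out') = (c1', out1')"
  shows "clones n k w (C(b := act A (clique n) k i (C b))) c1' out1'"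
proof -
  obtain c out where Cb: "C b = (c, out)" by fastforce
  note D = clonesD[OF cl b, unfolded Cb fst_conv snd_conv]
  define v where "v = pos c i"
  have v: "v < n" "v \<noteq> w" using D(1,2)[OF i] by (auto simp: v_def)
  let ?f = "\<lambda>j. j + b * k"
  have pres: "present (2 * k) c' (v + b * n) = ?f ` present k c v"
  proof -
    have "x \<in> present (2 * k) c' (v + b * n) \<longleftrightarrow> x \<in> ?f ` present k c v" for x
    proof (cases "x < 2 * k")
      case True
      then obtain j b' where x: "j < k" "b' < 2" "x = j + b' * k" by (rule copyE)
      have "pos c' x = pos (fst (C b')) j + b' * n" "pos (fst (C b')) j < n"
        using clonesD(1,3)[OF cl x(2,1)] x(3) by auto
      then show ?thesis
        using x v Cb copy_less[of j k b'] by (auto simp: present_def copy_eq_iff)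
    next
      case False
      then show ?thesis using copy_less[OF _ b, of _ k] by (auto simp: present_def)
    qed
    then show ?thesis by blast
  qed
  have inj: "inj_on ?f S" for S by (simp add: inj_on_def)
  \<comment> \<open>The agents met are the images of the original ones under an injective renaming,
    so the anonymous multiset of their states is the same.\<close>
  have "image_mset (st c') (mset_set (present (2 * k) c' (v + b * n) - {i + b * k})) =
    image_mset (st c') (mset_set (?f ` (present k c v - {i})))"
    unfolding pres by (rule arg_cong[where f = "\<lambda>S. image_mset (st c') (mset_set S)"]) auto
  also have "\<dots> = image_mset (\<lambda>j. st c' (?f j)) (mset_set (present k c v - {i}))"
    by (simp add: image_mset_mset_set[OF inj, symmetric] multiset.map_comp comp_def)
  also have "\<dots> = image_mset (st c) (mset_set (present k c v - {i}))"
    using D(4) by (intro image_mset_cong) (auto simp: present_def)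
  finally have others: "image_mset (st c') (mset_set (present (2 * k) c' (v + b * n) - {i + b * k})) =
    image_mset (st c) (mset_set (present k c v - {i}))" .
  obtain s bd m where A: "A (st c i) (image_mset (st c) (mset_set (present k c v - {i})))
      (ports (clique n) v) (inc c i) (wb c v) = (s, bd, m)"
    by (metis prod_cases3)
  have vi: "pos c' (i + b * k) = v + b * n" using D(3)[OF i] by (simp add: v_def)
  define K where "K = posted c v \<union> (\<Union>j \<in> present k c v. known c j)"
  define K' where "K' = posted c' (v + b * n) \<union> (\<Union>j \<in> present (2 * k) c' (v + b * n). known c' j)"
  have a: "act A (clique n) k i (C b) = (c\<lparr>st := (st c)(i := s), known := (known c)(i := K),
      wb := (wb c)(v := bd), posted := (posted c)(v := K)\<rparr>, out(i := m))"
    unfolding Cb act_def by (simp add: Let_def v_def[symmetric] A K_def)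
  have a': "c1' = c'\<lparr>st := (st c')(i + b * k := s), known := (known c')(i + b * k := K'),
      wb := (wb c')(v + b * n := bd), posted := (posted c')(v + b * n := K')\<rparr>"
    "out1' = out'(i + b * k := m)"
    using act' unfolding act_def
    by (simp_all add: Let_def vi others ports_double_clique[OF v b] D(4,5)[OF i] D(8)[OF v] A K'_def)
  have K': "K' \<subseteq> {b * k..<b * k + k}"
    using D(7) D(9)[OF v] unfolding K'_def pres by (fastforce simp: present_def)
  show ?thesis
    unfolding clones_def
  proof (intro allI impI)
    fix b' :: nat assume b': "b' < 2"
    note D' = clonesD[OF cl b']
    show "(\<forall>j<k. pos (fst ((C(b := act A (clique n) k i (C b))) b')) j < n \<and>
        pos (fst ((C(b := act A (clique n) k i (C b))) b')) j \<noteq> w \<and>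
        pos c1' (j + b' * k) = pos (fst ((C(b := act A (clique n) k i (C b))) b')) j + b' * n \<and>
        st c1' (j + b' * k) = st (fst ((C(b := act A (clique n) k i (C b))) b')) j \<and>
        inc c1' (j + b' * k) = inc (fst ((C(b := act A (clique n) k i (C b))) b')) j \<and>
        out1' (j + b' * k) = snd ((C(b := act A (clique n) k i (C b))) b') j \<and>
        known c1' (j + b' * k) \<subseteq> {b' * k..<b' * k + k}) \<and>
     (\<forall>x<n. x \<noteq> w \<longrightarrow> wb c1' (x + b' * n) = wb (fst ((C(b := act A (clique n) k i (C b))) b')) x \<and>
        posted c1' (x + b' * n) \<subseteq> {b' * k..<b' * k + k})"
    proof (cases "b' = b")
      case True
      show ?thesis unfolding a a' True using D K' i v by (auto simp: copy_eq_iff)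
    next
      case False
      then show ?thesis unfolding a' using D' i v by (auto simp: copy_eq_iff)
    qed
  qed
qed

lemma fold_act_clones:
  assumes "clones n k w C c' out'" "b < 2" "set xs \<subseteq> {..<k}"
    and "fold (act A (double_clique n w) (2 * k)) (map (\<lambda>i. i + b * k) xs) (c', out') = (c1', out1')"
  shows "clones n k w (C(b := fold (act A (clique n) k) xs (C b))) c1' out1'"
  using assms(1,3,4)
proof (induction xs arbitrary: C c' out')
  case (Cons x xs)
  obtain c0 out0 where a: "act A (double_clique n w) (2 * k) (x + b * k) (c', out') = (c0, out0)"
    by fastforce
  have "clones n k w (C(b := act A (clique n) k x (C b))) c0 out0"
    by (rule act_clones[OF _ assms(2) _ a]) (use Cons.prems in auto)
  from Cons.IH[OF this] have "clones n k w ((C(b := act A (clique n) k x (C b)))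
      (b := fold (act A (clique n) k) xs ((C(b := act A (clique n) k x (C b))) b))) c1' out1'"
    using Cons.prems(2,3) a by (metis fold_simps(2) insert_subset list.set(2) list.simps(9))
  then show ?case by (simp only: fun_upd_upd fun_upd_same fold_simps)
qed simp

text \<open>By \<open>admissible_progress\<close> a round without moves has no attempts. Then the
  copies make none either, and the empty set of moves is admissible for both kinds of links.\<close>

lemma still_round_clones:
  assumes n: "n > 0" and cl: "clones n k w (\<lambda>_. (c, \<lambda>_. None)) c' (\<lambda>_. None)"
    and r: "round_step d A (clique n) k c cn" and still: "\<And>i. i < k \<Longrightarrow> pos cn i = pos c i"
  shows "\<exists>cn'. round_step d A (double_clique n w) (2 * k) c' cn' \<and>
           clones n k w (\<lambda>_. (cn, \<lambda>_. None)) cn' (\<lambda>_. None)"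
proof -
  obtain ord M c1 out where ord: "distinct ord" "set ord = {..<k}"
    and f: "fold (act A (clique n) k) ord (c, \<lambda>_. None) = (c1, out)"
    and M: "admissible d (crossers (clique n) k c1 out) M"
    and mv: "\<And>i. i < k \<Longrightarrow> if i \<in> M
           then i \<in> crossers (clique n) k c1 out (pos c i) (pos cn i) \<and>
                inc cn i = Some (port (clique n) (pos cn i) (pos c i))
           else pos cn i = pos c i \<and> inc cn i = None"
    and cn: "st cn = st c1" "wb cn = tick \<circ> wb c1"
    using r unfolding round_step_def by metis
  have stat: "pos c1 = pos c" using fold_act_static[OF f] by simp
  have "i \<notin> M" for i
  proof
    assume iM: "i \<in> M"
    then have "i < k" using admissible_subset[OF M] by (auto simp: crossers_def present_def)
    then show False using mv[of i] iM still by (auto simp: crossers_def nbrs_def clique_def)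
  qed
  then have "M = {}" by blast
  then have nocross: "crossers (clique n) k c1 out u v = {}" for u v
    using admissible_progress[OF M] by blast
  have inc_cn: "inc cn i = None" if "i < k" for i using mv[OF that] \<open>M = {}\<close> by simp
  let ?N = "double_clique n w"
  \<comment> \<open>All of copy 0 acts before copy 1, each in the order \<open>ord\<close>, so both
    copies end in \<open>(c1, out)\<close>.\<close>
  let ?ord = "map (\<lambda>i. i + 0 * k) ord @ map (\<lambda>i. i + 1 * k) ord"
  obtain c0' out0' where f0: "fold (act A ?N (2 * k)) (map (\<lambda>i. i + 0 * k) ord) (c', \<lambda>_. None) = (c0', out0')"
    by fastforce
  obtain c1' out1' where f1: "fold (act A ?N (2 * k)) (map (\<lambda>i. i + 1 * k) ord) (c0', out0') = (c1', out1')"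
    by fastforce
  have "clones n k w ((\<lambda>_. (c, \<lambda>_. None))(0 := (c1, out), 1 := (c1, out))) c1' out1'"
    using fold_act_clones[OF fold_act_clones[OF cl _ _ f0] _ _ f1] ord f by auto
  then have cl1: "clones n k w (\<lambda>_. (c1, out)) c1' out1'"
    unfolding clones_def by (auto simp: less_2_cases_iff)
  note D = clonesD[OF cl1, simplified]
  have nocross': "crossers ?N (2 * k) c1' out1' u v = {}" for u v
  proof (rule ccontr)
    assume "crossers ?N (2 * k) c1' out1' u v \<noteq> {}"
    then obtain x where x: "x < 2 * k" "pos c1' x = u" "v \<in> nbrs ?N u" "out1' x = Some (port ?N u v)"
      by (auto simp: crossers_def present_def)
    obtain i b where i: "i < k" "b < 2" "x = i + b * k" using x(1) by (rule copyE)
    have u: "u = pos c1 i + b * n" "pos c1 i < n" "pos c1 i \<noteq> w" using D(1,2,3)[OF i(2,1)] x i by auto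
    then obtain y where y: "y \<in> nbrs (clique n) (pos c1 i)" "v = y + b * n"
      using x(3) nbrs_double_clique[OF u(2,3) i(2)] by auto
    then have "port ?N u v = port (clique n) (pos c1 i) y"
      by (auto simp: double_clique_def clique_def nbrs_def)
    then have "i \<in> crossers (clique n) k c1 out (pos c1 i) y"
      using D(6)[OF i(2,1)] x(4) i y by (simp add: crossers_def present_def)
    then show False using nocross by blast
  qed
  define cn' where "cn' = c1'\<lparr>inc := \<lambda>_. None, wb := tick \<circ> wb c1'\<rparr>"
  have "pos c1' = pos c'" using fold_act_static[OF f0] fold_act_static[OF f1] by simp
  moreover have "distinct ?ord"
    using ord by (auto simp: distinct_map inj_on_def)
  moreover have "set ?ord = {..<2 * k}"
  proof (intro equalityI subsetI)
    fix x assume "x \<in> {..<2 * k}"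
    then have "x < 2 * k" by simp
    then obtain i b where "i < k" "b < 2" "x = i + b * k" by (rule copyE)
    then show "x \<in> set ?ord" using ord(2) by (auto dest!: less_2_cases)
  qed (auto simp: ord(2))
  moreover have "(c1', out1') = fold (act A ?N (2 * k)) ?ord (c', \<lambda>_. None)"
    by (simp only: fold_append comp_apply f0 f1)
  moreover have "admissible d (crossers ?N (2 * k) c1' out1') {}"
    by (cases d) (auto simp: nocross')
  ultimately have "round_step d A ?N (2 * k) c' cn'"
    unfolding round_step_def
    by (intro exI[of _ ?ord] exI[of _ "{}"] exI[of _ c1'] exI[of _ out1']) (simp add: cn'_def)
  moreover have "clones n k w (\<lambda>_. (cn, \<lambda>_. None)) cn' (\<lambda>_. None)"
    using cl1 inc_cn still unfolding clones_def
    by (auto simp: cn'_def cn stat)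
  ultimately show ?thesis by blast
qed

lemma not_all_quiescent:
  assumes k: "k \<ge> 1" and ss: "self_stabilizing d A"
  shows "\<not> quiescent d k (int k) A"
proof
  assume q: "quiescent d k (int k) A"
  \<comment> \<open>One node more than agents, so that wherever they stop some node is free.\<close>
  define n where "n = Suc k"
  let ?N = "clique n"
  have N: "network ?N" by (rule network_clique) (simp add: n_def)
  define c where "c = \<lparr>pos = \<lambda>_. 0, st = \<lambda>_. 0, inc = \<lambda>_. None, known = \<lambda>i. {i},
    wb = \<lambda>_. (0, []), posted = \<lambda>_. {}\<rparr>"
  have "initial ?N k id c" by (auto simp: initial_def c_def clique_def n_def)
  then obtain e where e: "execution d A ?N k id e" using execution_exists[OF N] by blast
  then have step: "\<And>t. round_step d A ?N k (e t) (e (Suc t))" by (simp add: execution_def)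
  obtain t where "int k \<le> int (card {i. i < k \<and> still_from e t i})"
    using q N e unfolding quiescent_def by blast
  then have "{i. i < k \<and> still_from e t i} = {..<k}" by (intro card_seteq) auto
  then have still: "pos (e t') i = pos (e t) i" if "i < k" "t' \<ge> t" for t' i
    using that unfolding still_from_def by blast
  have inn: "inc (e (Suc t')) i = None" if "i < k" "t' \<ge> t" for t' i
    using round_step_moves[OF N step that(1), of t'] networkD(6)[OF N]
      still[OF that(1), of t'] still[OF that(1), of "Suc t'"] that by auto
  have "card (pos (e t) ` {..<k}) \<le> k" using card_image_le[of "{..<k}" "pos (e t)"] by simp
  then have "\<not> {..<n} \<subseteq> pos (e t) ` {..<k}" using card_mono[of "pos (e t) ` {..<k}" "{..<n}"]
    by (auto simp: n_def)
  then obtain w where w: "w < n" "w \<notin> pos (e t) ` {..<k}" by blast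
  have N': "network (double_clique n w)" by (rule network_double_clique[OF w(1)])
  \<comment> \<open>At time \<open>t\<close> an agent may have just arrived and still see an
    incoming label; one round later all these labels are \<open>None\<close>.\<close>
  let ?s = "Suc t"
  define c0 where "c0 = \<lparr>pos = \<lambda>x. pos (e ?s) (x mod k) + x div k * n, st = \<lambda>x. st (e ?s) (x mod k),
    inc = \<lambda>_. None, known = \<lambda>x. {x}, wb = \<lambda>v. wb (e ?s) (v mod n), posted = \<lambda>_. {}\<rparr>"
  have pos_lt: "pos (e t') i < n" if "i < k" for i t'
    using execution_wellplaced[OF N e] that by (auto simp: wellplaced_def clique_def)
  have notw: "pos (e ?s) i \<noteq> w" if "i < k" for i
    using still[OF that, of ?s] w(2) that by force
  have cl0: "clones n k w (\<lambda>_. (e (?s + 0), \<lambda>_. None)) c0 (\<lambda>_. None)"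
    using pos_lt notw inn[OF _ order_refl] unfolding clones_def by (auto simp: c0_def)
  have "\<exists>e'. \<forall>r. (clones n k w (\<lambda>_. (e (?s + r), \<lambda>_. None)) (e' r) (\<lambda>_. None) \<and> (r = 0 \<longrightarrow> e' r = c0)) \<and>
      round_step d A (double_clique n w) (2 * k) (e' r) (e' (Suc r))"
  proof (rule dependent_nat_choice)
    show "\<exists>x. clones n k w (\<lambda>_. (e (?s + 0), \<lambda>_. None)) x (\<lambda>_. None) \<and> (0 = 0 \<longrightarrow> x = c0)"
      using cl0 by blast
    fix x and r :: nat
    assume "clones n k w (\<lambda>_. (e (?s + r), \<lambda>_. None)) x (\<lambda>_. None) \<and> (r = 0 \<longrightarrow> x = c0)"
    then have "clones n k w (\<lambda>_. (e (?s + r), \<lambda>_. None)) x (\<lambda>_. None)" by blast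
    moreover have "pos (e (Suc (?s + r))) i = pos (e (?s + r)) i" if "i < k" for i
      using still[OF that, of "?s + r"] still[OF that, of "Suc (?s + r)"] by simp
    ultimately obtain y where "round_step d A (double_clique n w) (2 * k) x y"
      "clones n k w (\<lambda>_. (e (Suc (?s + r)), \<lambda>_. None)) y (\<lambda>_. None)"
      using still_round_clones[OF _ _ step[of "?s + r"], of w x] by (auto simp: n_def)
    then show
      "\<exists>y. (clones n k w (\<lambda>_. (e (?s + Suc r), \<lambda>_. None)) y (\<lambda>_. None) \<and> (Suc r = 0 \<longrightarrow> y = c0)) \<and>
         round_step d A (double_clique n w) (2 * k) x y"
      by auto
  qed
  then obtain e' where cl: "\<And>r. clones n k w (\<lambda>_. (e (?s + r), \<lambda>_. None)) (e' r) (\<lambda>_. None)"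
    and e'0: "e' 0 = c0"
    and step': "\<And>r. round_step d A (double_clique n w) (2 * k) (e' r) (e' (Suc r))"
    by blast
  have "initial (double_clique n w) (2 * k) id c0"
    unfolding initial_def
  proof (intro allI impI)
    fix x assume "x < 2 * k"
    then obtain i b where "i < k" "b < 2" "x = i + b * k" by (rule copyE)
    then show "pos c0 x \<in> pverts (topo (double_clique n w)) \<and>
        set_option (inc c0 x) \<subseteq> ports (double_clique n w) (pos c0 x) \<and> id x \<in> known c0 x"
      using copy_less[OF pos_lt, of i b ?s] by (auto simp: c0_def double_clique_def)
  qed
  then have "execution d A (double_clique n w) (2 * k) id e'"
    using step' e'0 by (simp add: execution_def)
  then have "\<forall>i<2 * k. \<exists>r. \<forall>j<2 * k. id j \<in> known (e' r) i"
    using ss N' unfolding self_stabilizing_def by blast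
  then have "\<exists>r. \<forall>j<2 * k. id j \<in> known (e' r) 0" using k by simp
  then obtain r where "\<forall>j<2 * k. id j \<in> known (e' r) 0" by blast
  \<comment> \<open>Gossip \<open>k\<close> belongs to the first agent of copy 1, while agent 0 of
    copy 0 can only hold gossip below \<open>k\<close>.\<close>
  then have "k \<in> known (e' r) 0" using k by simp
  then show False using clonesD(7)[OF cl, of 0 0 r] k by auto
qed

theorem theorem10:
  fixes d :: duplex and k :: nat
  assumes "k \<ge> 1"
  shows "quiescence_number d k \<le> int k - 1 \<and> 0 \<le> quiescence_number d k"
proof -
  let ?P = "\<lambda>l. \<exists>A. quiescent_solution d k l A"
  \<comment> \<open>For \<open>l = 0\<close> quiescence asks nothing beyond a nonnegative
    cardinality.\<close>
  have P0: "?P 0"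
    using self_stabilizing_rotor by (auto simp: quiescent_solution_def quiescent_def)
  have upper: "l \<le> int k - 1" if Pl: "?P l" for l
  proof (rule ccontr)
    assume "\<not> ?thesis"
    then have "int k \<le> l" by simp
    obtain A where "self_stabilizing d A" "quiescent d k l A"
      using Pl unfolding quiescent_solution_def by blast
    moreover from this have "quiescent d k (int k) A"
      using \<open>int k \<le> l\<close> unfolding quiescent_def by (meson order_trans)
    ultimately show False using not_all_quiescent[OF assms] by blast
  qed
  \<comment> \<open>Negative \<open>l\<close> satisfy \<open>?P\<close> as well; cutting them off
    leaves a finite set whose maximum is the value of \<open>GREATEST\<close>.\<close>
  let ?S = "{l \<in> {0..int k - 1}. ?P l}"
  have S: "finite ?S" "0 \<in> ?S"
    using P0 assms by (auto intro: finite_subset[of _ "{0..int k - 1}"])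
  have "(GREATEST l. ?P l) = Max ?S"
  proof (rule Greatest_equality)
    show "?P (Max ?S)" using Max_in[of ?S] S by blast
    fix l assume "?P l"
    then have "l < 0 \<or> l \<in> ?S" using upper by auto
    then show "l \<le> Max ?S" using Max_ge[OF S(1)] S(2) by (meson less_imp_le order_trans)
  qed
  moreover have "Max ?S \<in> ?S" using Max_in[of ?S] S by blast
  ultimately show ?thesis using P0 by (simp add: quiescence_number_def)
qed

end
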